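(* Let $n\geq 1$ and let $h,k$ be nonnegative integers. If $n$ is odd, then $$D_q(h+n,k+n)\equiv D_q(h+n,k)+D_q(h,k+n)+D_q(h,k)\pmod{\Phi_n(q)},$$ and if $n$ is even, then $$D_q(h+n,k+n)\equiv D_q(h+n,k)+D_q(h,k+n)-D_q(h,k)\pmod{\Phi_n(q)},$$ where the congruences are in $\mathbb{Z}[q]$.
   Context: $\Phi_n(q)$ denotes the $n$-th cyclotomic polynomial. The $q$-integer is $[m]_q=(1-q^m)/(1-q)$ and the $q$-binomial coefficient is $\left[{h\atop k}\right]_q=\frac{[h]_q[h-1]_q\cdots[h-k+1]_q}{[k]_q[k-1]_q\cdots[1]_q}$, with $\left[{h\atop 0}\right]_q=1$ and $\left[{h\atop k}\right]_q=0$ for $k<0$. For nonnegative integers $h,k$ the $q$-Delannoy number is $D_q(h,k)=\sum_{j=0}^{h}q^{\binom{j+1}{2}}\left[{k\atop j}\right]_q\left[{h+k-j\atop k}\right]_q$. *)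

theory Defs
  imports Complex_Main "HOL-Computational_Algebra.Polynomial"
begin

definition primitive_unity_roots :: "nat \<Rightarrow> complex set" where
  "primitive_unity_roots n = {z. z ^ n = 1 \<and> (\<forall>m. 0 < m \<and> m < n \<longrightarrow> z ^ m \<noteq> 1)}"

text \<open>
  The integer polynomial whose image in \<open>\<complex>[q]\<close> is the product of \<open>q - z\<close> over the primitive
  \<open>n\<close>-th roots of unity \<open>z\<close>; existence for \<open>n > 0\<close> is \<open>of_int_cyclotomic\<close> below.
\<close>

definition cyclotomic :: "nat \<Rightarrow> int poly" where
  "cyclotomic n =
     (THE p. map_poly of_int p = (\<Prod>z\<in>primitive_unity_roots n. [:- z, 1:]))"

text \<open>
  In \<open>q_int\<close> and \<open>q_binomial\<close>, \<open>div\<close> is exact division in \<open>\<int>[q]\<close>: see \<open>q_int_mult\<close> and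
  \<open>q_binomial_mult\<close> below. The truncated subtraction in \<open>q_int (h - i)\<close> is harmless: for \<open>k > h\<close>
  the numerator contains the factor \<open>q_int 0 = 0\<close>. Negative lower indices never arise in
  \<open>q_delannoy\<close>, so all indices are natural numbers.
\<close>

definition q_int :: "nat \<Rightarrow> int poly" where
  "q_int m = (1 - monom 1 m) div (1 - monom 1 1)"

definition q_binomial :: "nat \<Rightarrow> nat \<Rightarrow> int poly" where
  "q_binomial h k = (\<Prod>i<k. q_int (h - i)) div (\<Prod>i<k. q_int (k - i))"

definition q_delannoy :: "nat \<Rightarrow> nat \<Rightarrow> int poly" where
  "q_delannoy h k =
     (\<Sum>j=0..h. monom 1 ((j + 1) choose 2) * q_binomial k j * q_binomial (h + k - j) k)"


lemma one_minus_q_dvd: "(1 - monom 1 1 :: int poly) dvd 1 - monom 1 m"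
proof -
  have "(1 - monom 1 1 ^ m :: int poly) = (1 - monom 1 1) * (\<Sum>i<m. monom 1 1 ^ i)"
    by (rule one_diff_power_eq)
  then show ?thesis by (simp add: monom_power)
qed

lemma q_int_mult: "q_int m * (1 - monom 1 1) = 1 - monom 1 m"
  unfolding q_int_def using one_minus_q_dvd by (rule dvd_div_mult_self)

lemma one_minus_q_neq_0: "(1 - monom 1 1 :: int poly) \<noteq> 0"
proof
  assume "(1 - monom 1 1 :: int poly) = 0"
  then have "coeff (1 - monom 1 1 :: int poly) 0 = 0" by simp
  then show False by simp
qed

lemma q_int_0 [simp]: "q_int 0 = 0"
  by (simp add: q_int_def)

lemma q_int_neq_0: "m > 0 \<Longrightarrow> q_int m \<noteq> 0"
proof
  assume m: "m > 0" and "q_int m = 0"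
  then have "coeff (1 - monom 1 m :: int poly) 0 = 0" using q_int_mult[of m] by simp
  then show False using m by simp
qed

lemma q_int_add: "q_int (a + b) = q_int a + monom 1 a * q_int b"
proof -
  have "(q_int a + monom 1 a * q_int b) * (1 - monom 1 1)
      = q_int a * (1 - monom 1 1) + monom 1 a * (q_int b * (1 - monom 1 1))"
    by (simp add: algebra_simps)
  also have "\<dots> = 1 - monom 1 (a + b)"
    unfolding q_int_mult by (simp add: algebra_simps mult_monom)
  also have "\<dots> = q_int (a + b) * (1 - monom 1 1)" by (simp only: q_int_mult)
  finally show ?thesis using one_minus_q_neq_0 by simp
qed

lemma q_binomial_dvd: "(\<Prod>i<k. q_int (k - i)) dvd (\<Prod>i<k. q_int (h - i))"
proof (induction h arbitrary: k)
  case 0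
  show ?case by (cases k) (simp_all add: prod.lessThan_Suc_shift)
next
  case (Suc h)
  show ?case
  proof (cases k)
    case 0
    then show ?thesis by simp
  next
    case k: (Suc l)
    have shift: "(\<Prod>i<Suc l. q_int (Suc m - i)) = q_int (Suc m) * (\<Prod>i<l. q_int (m - i))" for m
      by (simp only: prod.lessThan_Suc_shift o_def diff_Suc_Suc diff_zero)
    have zero: "(\<Prod>i<l. q_int (h - i)) = 0" if "l > h"
      using that by (intro prod_zero) (auto intro!: bexI[of _ h])
    show ?thesis
    proof (cases "l > h")
      case True
      then show ?thesis unfolding k shift by (simp add: zero)
    next
      case False
      then have "Suc h = Suc l + (h - l)" by simp
      then have "q_int (Suc h) = q_int (Suc l) + monom 1 (Suc l) * q_int (h - l)"
        by (metis q_int_add)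
      then have "(\<Prod>i<Suc l. q_int (Suc h - i))
          = q_int (Suc l) * (\<Prod>i<l. q_int (h - i)) + monom 1 (Suc l) * (\<Prod>i<Suc l. q_int (h - i))"
        unfolding shift by (simp add: algebra_simps)
      moreover have "(\<Prod>i<Suc l. q_int (Suc l - i)) dvd q_int (Suc l) * (\<Prod>i<l. q_int (h - i))"
        unfolding shift using Suc.IH[of l] by (rule mult_dvd_mono[OF dvd_refl])
      moreover have "(\<Prod>i<Suc l. q_int (Suc l - i)) dvd monom 1 (Suc l) * (\<Prod>i<Suc l. q_int (h - i))"
        using Suc.IH[of "Suc l"] by (rule dvd_mult)
      ultimately show ?thesis unfolding k by simp
    qed
  qed
qed

lemma q_binomial_mult:
  "q_binomial h k * (\<Prod>i<k. q_int (k - i)) = (\<Prod>i<k. q_int (h - i))"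
  unfolding q_binomial_def using q_binomial_dvd by (rule dvd_div_mult_self)


lemma finite_primitive_unity_roots: "n > 0 \<Longrightarrow> finite (primitive_unity_roots n)"
  by (rule finite_subset[OF _ finite_roots_unity[of n]]) (auto simp: primitive_unity_roots_def)

lemma unity_roots_decomp:
  assumes n: "n > 0"
  shows "{z. z ^ n = 1} = (\<Union>d\<in>{d. d dvd n}. primitive_unity_roots d)"
proof (intro equalityI subsetI)
  fix z :: complex assume "z \<in> {z. z ^ n = 1}"
  then have z: "z ^ n = 1" by simp
  define d where "d = (LEAST m. 0 < m \<and> z ^ m = 1)"
  have d: "0 < d \<and> z ^ d = 1" unfolding d_def by (rule LeastI[of _ n]) (use n z in simp)
  have least: "z ^ m \<noteq> 1" if "0 < m" "m < d" for m
    using not_less_Least[of m "\<lambda>m. 0 < m \<and> z ^ m = 1"] that unfolding d_def by blast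
  have "z ^ n = z ^ (d * (n div d) + n mod d)" by simp
  also have "\<dots> = z ^ (n mod d)" unfolding power_add power_mult using d by simp
  finally have "z ^ (n mod d) = 1" using z by simp
  then have "n mod d = 0" using least[of "n mod d"] d by (metis gr0I mod_less_divisor)
  then show "z \<in> (\<Union>d\<in>{d. d dvd n}. primitive_unity_roots d)"
    using d least by (auto simp: primitive_unity_roots_def)
next
  fix z :: complex assume "z \<in> (\<Union>d\<in>{d. d dvd n}. primitive_unity_roots d)"
  then obtain d where "d dvd n" "z ^ d = 1" by (auto simp: primitive_unity_roots_def)
  then show "z \<in> {z. z ^ n = 1}" by (auto elim!: dvdE simp: power_mult)
qed

lemma primitive_unity_roots_disjoint:
  assumes "0 < d" "0 < e" "d \<noteq> e"
  shows "primitive_unity_roots d \<inter> primitive_unity_roots e = {}"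
proof -
  have "False" if "z ^ d = 1" "z ^ e = 1" "\<forall>m. 0 < m \<and> m < d \<longrightarrow> z ^ m \<noteq> 1"
    "\<forall>m. 0 < m \<and> m < e \<longrightarrow> z ^ m \<noteq> 1" for z :: complex
    using that assms by (cases d e rule: linorder_cases) auto
  then show ?thesis unfolding primitive_unity_roots_def by blast
qed

lemma prod_linear_factors_props:
  "finite A \<Longrightarrow> degree (\<Prod>z\<in>A. [:- z, 1:] :: complex poly) = card A
     \<and> lead_coeff (\<Prod>z\<in>A. [:- z, 1:] :: complex poly) = 1"
  by (intro conjI, simp add: degree_prod_eq_sum_degree)
    (simp only: lead_coeff_prod, simp)

lemma prod_unity_roots:
  assumes n: "n > 0"
  shows "(\<Prod>z\<in>{z. z ^ n = 1}. [:- z, 1:]) = (monom 1 n - 1 :: complex poly)" (is "?P = ?Q")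
proof (rule ccontr)
  assume neq: "?P \<noteq> ?Q"
  let ?U = "{z :: complex. z ^ n = 1}"
  have fin: "finite ?U" using n by (intro finite_roots_unity) simp
  have card: "card ?U = n" using n by (rule card_roots_unity_eq)
  have P: "degree ?P = n" "lead_coeff ?P = 1" using prod_linear_factors_props[OF fin] card by auto
  have dQ: "degree ?Q \<le> n"
    by (rule order.trans[OF degree_diff_le_max]) (simp add: degree_monom_le)
  have "coeff (?P - ?Q) n = 0" using P n by simp
  moreover have "degree (?P - ?Q) \<le> n" using P(1) dQ by (metis degree_diff_le order.refl)
  ultimately have deg: "degree (?P - ?Q) < n"
    using n neq by (metis eq_iff_diff_eq_0 le_neq_implies_less leading_coeff_0_iff)
  have "?U \<subseteq> {x. poly (?P - ?Q) x = 0}"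
  proof
    fix z assume z: "z \<in> ?U"
    have "poly ?P z = (\<Prod>w\<in>?U. poly [:- w, 1:] z)" by (rule poly_prod)
    also have "\<dots> = 0" using z fin by (intro prod_zero) auto
    finally show "z \<in> {x. poly (?P - ?Q) x = 0}" using z by (simp add: poly_monom)
  qed
  then have "n \<le> card {x. poly (?P - ?Q) x = 0}"
    using card neq by (metis card_mono poly_roots_finite eq_iff_diff_eq_0)
  also have "\<dots> \<le> degree (?P - ?Q)" using neq by (intro card_poly_roots_bound) simp
  finally show False using deg by simp
qed

lemma cyclotomic_exists:
  assumes "n > 0"
  shows "\<exists>p :: int poly. map_poly of_int p = (\<Prod>z\<in>primitive_unity_roots n. [:- z, 1:])"
  using assms
proof (induction n rule: less_induct)
  case (less n)
  define C where "C = (\<lambda>d. \<Prod>z\<in>primitive_unity_roots d. [:- z, 1 :: complex:])"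
  let ?h = "map_poly of_int :: int poly \<Rightarrow> complex poly"
  have h_mult: "?h (p * q) = ?h p * ?h q" for p q
    by (rule poly_eqI) (simp add: coeff_map_poly coeff_mult)
  have h_add: "?h (p + q) = ?h p + ?h q" for p q
    by (rule poly_eqI) (simp add: coeff_map_poly)
  have h_prod: "?h (\<Prod>d\<in>S. f d) = (\<Prod>d\<in>S. ?h (f d))" for S :: "nat set" and f
    by (induction S rule: infinite_finite_induct) (simp_all add: h_mult)
  have h_deg: "degree (?h p) = degree p" for p
    by (simp add: degree_map_poly)
  define S where "S = {d. d dvd n} - {n}"
  have S: "finite S" "\<And>d. d \<in> S \<Longrightarrow> 0 < d \<and> d < n"
    using less.prems by (auto simp: S_def dest: dvd_imp_le intro: dvd_pos_nat intro!: Nat.gr0I)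
  have "\<forall>d\<in>S. \<exists>p. ?h p = C d" using less.IH S(2) unfolding C_def by blast
  then obtain f where f: "\<And>d. d \<in> S \<Longrightarrow> ?h (f d) = C d" by metis
  define P where "P = (\<Prod>d\<in>S. f d)"
  have hP: "?h P = (\<Prod>d\<in>S. C d)" unfolding P_def h_prod by (simp add: f)
  have "lead_coeff (C d) = 1" if "d \<in> S" for d
    unfolding C_def using prod_linear_factors_props finite_primitive_unity_roots S(2)[OF that] by blast
  then have "lead_coeff (?h P) = 1" unfolding hP by (simp add: lead_coeff_prod)
  then have lP: "lead_coeff P = 1" by (simp add: h_deg coeff_map_poly)
  then have P0: "P \<noteq> 0" by auto
  have "monom 1 n - 1 = (\<Prod>z\<in>{z. z ^ n = 1}. [:- z, 1 :: complex:])"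
    using prod_unity_roots[OF less.prems] by simp
  also have "\<dots> = (\<Prod>d | d dvd n. C d)"
    unfolding unity_roots_decomp[OF less.prems] C_def
    using less.prems
    by (intro prod.UNION_disjoint ballI impI finite_primitive_unity_roots
        primitive_unity_roots_disjoint) (auto intro: dvd_pos_nat)
  also have "\<dots> = C n * ?h P"
    unfolding hP S_def using less.prems by (intro prod.remove) auto
  finally have eq: "monom 1 n - 1 = C n * ?h P" .
  obtain Q R where QR: "pseudo_divmod (monom 1 n - 1) P = (Q, R)" by fastforce
  have div: "monom 1 n - 1 = P * Q + R" and R: "R = 0 \<or> degree R < degree P"
    using pseudo_divmod[OF P0 QR] lP by simp_all
  have "monom 1 n - 1 = ?h (monom 1 n - 1)"
    by (rule poly_eqI) (simp add: coeff_map_poly)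
  also have "\<dots> = ?h P * ?h Q + ?h R" unfolding div h_add h_mult ..
  finally have hR: "?h R = ?h P * (C n - ?h Q)" unfolding eq by (simp add: algebra_simps)
  have hP0: "?h P \<noteq> 0" using \<open>lead_coeff (?h P) = 1\<close> by auto
  have "C n - ?h Q = 0"
  proof (rule ccontr)
    assume "C n - ?h Q \<noteq> 0"
    then have "degree (?h P) \<le> degree (?h R)" and "?h R \<noteq> 0"
      unfolding hR using hP0 by (simp_all add: degree_mult_eq)
    then show False using R by (auto simp: h_deg)
  qed
  then show ?case unfolding C_def by (intro exI[of _ Q]) simp
qed

lemma of_int_cyclotomic:
  assumes "n > 0"
  shows "map_poly of_int (cyclotomic n) = (\<Prod>z\<in>primitive_unity_roots n. [:- z, 1:])"
proof -
  have inj: "p = q" if "map_poly of_int p = (map_poly of_int q :: complex poly)" for p q :: "int poly"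
  proof (rule poly_eqI)
    fix i
    have "coeff (map_poly of_int p :: complex poly) i = coeff (map_poly of_int q) i"
      using that by simp
    then show "coeff p i = coeff q i" by (simp add: coeff_map_poly)
  qed
  obtain p :: "int poly"
    where p: "map_poly of_int p = (\<Prod>z\<in>primitive_unity_roots n. [:- z, 1:])"
    using cyclotomic_exists[OF assms] by blast
  show ?thesis unfolding cyclotomic_def
    by (rule theI[of "\<lambda>p. map_poly of_int p = _", OF p]) (metis inj p)
qed

end

theory Submission
  imports Defs "HOL-Computational_Algebra.Polynomial_FPS"
begin

text \<open>
  By the two \<open>q\<close>-Pascal rules, \<open>G k = (\<Sum>h. D(h, k) X^h)\<close> satisfies
  \<open>(1 - q^(k+1) X) G (k+1) = (1 + q^(k+1) X) G k\<close>. At a primitive \<open>n\<close>-th root of unity \<open>q = z\<close>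
  the powers of \<open>z\<close> met in \<open>n\<close> consecutive steps are all the \<open>n\<close>-th roots of unity, so that
  \<open>(1 - X^n) G (k+n) = (1 - (-X)^n) G k\<close>. Comparing coefficients of \<open>X^(h+n)\<close> gives the
  congruence at every root of the monic, squarefree polynomial \<open>cyclotomic n\<close>.
\<close>

section \<open>Recurrences for \<open>q\<close>-binomials and \<open>q\<close>-Delannoy numbers\<close>

lemma prod_q_int_Suc_shift:
  "(\<Prod>i<Suc l. q_int (Suc m - i)) = q_int (Suc m) * (\<Prod>i<l. q_int (m - i))"
  by (simp only: prod.lessThan_Suc_shift o_def diff_Suc_Suc diff_zero)

lemma prod_q_int_neq_0: "(\<Prod>i<k. q_int (k - i)) \<noteq> 0"
  by (auto simp: q_int_neq_0)

text \<open>The denominator is nonzero in an integral domain, so it cancels and \<open>div\<close>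
  need not be unfolded again.\<close>

lemma q_binomial_eqI:
  assumes "p * (\<Prod>i<k. q_int (k - i)) = (\<Prod>i<k. q_int (h - i))"
  shows "q_binomial h k = p"
  using assms q_binomial_mult[of h k] prod_q_int_neq_0[of k] by (metis mult_right_cancel)

lemma q_binomial_0_right [simp]: "q_binomial h 0 = 1"
  by (rule q_binomial_eqI) simp

lemma q_binomial_eq_0: "h < k \<Longrightarrow> q_binomial h k = 0"
  by (rule q_binomial_eqI) (auto intro!: prod_zero[symmetric] bexI[of _ h])

lemma q_binomial_self [simp]: "q_binomial k k = 1"
  by (rule q_binomial_eqI) simp

text \<open>Comes from splitting \<open>q_int (Suc h)\<close> after the first \<open>Suc k\<close>
  terms of its geometric sum.\<close>

lemma q_binomial_Suc_Suc:
  "q_binomial (Suc h) (Suc k) = q_binomial h k + monom 1 (Suc k) * q_binomial h (Suc k)"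
proof (cases "k \<le> h")
  case False
  then show ?thesis by (simp add: q_binomial_eq_0)
next
  case True
  then have q: "q_int (Suc h) = q_int (Suc k) + monom 1 (Suc k) * q_int (h - k)"
    using q_int_add[of "Suc k" "h - k"] by simp
  show ?thesis
  proof (rule q_binomial_eqI)
    have "(q_binomial h k + monom 1 (Suc k) * q_binomial h (Suc k)) * (\<Prod>i<Suc k. q_int (Suc k - i))
        = q_int (Suc k) * (q_binomial h k * (\<Prod>i<k. q_int (k - i)))
          + monom 1 (Suc k) * (q_binomial h (Suc k) * (\<Prod>i<Suc k. q_int (Suc k - i)))"
      by (simp only: prod_q_int_Suc_shift[of k k] algebra_simps)
    also have "\<dots> = (\<Prod>i<Suc k. q_int (Suc h - i))"
      unfolding q_binomial_mult unfolding prod_q_int_Suc_shift q by (simp add: algebra_simps)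
    finally show "(q_binomial h k + monom 1 (Suc k) * q_binomial h (Suc k))
        * (\<Prod>i<Suc k. q_int (Suc k - i)) = (\<Prod>i<Suc k. q_int (Suc h - i))" .
  qed
qed

text \<open>Here the geometric sum is split after \<open>h - k\<close> terms instead. If
  \<open>h < k\<close>, the truncated exponent is harmless because
  \<open>q_binomial h k = 0\<close>.\<close>

lemma q_binomial_Suc_Suc':
  "q_binomial (Suc h) (Suc k) = q_binomial h (Suc k) + monom 1 (h - k) * q_binomial h k"
proof (cases "k \<le> h")
  case False
  then show ?thesis by (simp add: q_binomial_eq_0)
next
  case True
  then have q: "q_int (Suc h) = q_int (h - k) + monom 1 (h - k) * q_int (Suc k)"
    using q_int_add[of "h - k" "Suc k"] by simp
  show ?thesis
  proof (rule q_binomial_eqI)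
    have "(q_binomial h (Suc k) + monom 1 (h - k) * q_binomial h k) * (\<Prod>i<Suc k. q_int (Suc k - i))
        = q_binomial h (Suc k) * (\<Prod>i<Suc k. q_int (Suc k - i))
          + monom 1 (h - k) * q_int (Suc k) * (q_binomial h k * (\<Prod>i<k. q_int (k - i)))"
      by (simp only: prod_q_int_Suc_shift[of k k] algebra_simps)
    also have "\<dots> = (\<Prod>i<Suc k. q_int (Suc h - i))"
      unfolding q_binomial_mult unfolding prod_q_int_Suc_shift q by (simp add: algebra_simps)
    finally show "(q_binomial h (Suc k) + monom 1 (h - k) * q_binomial h k)
        * (\<Prod>i<Suc k. q_int (Suc k - i)) = (\<Prod>i<Suc k. q_int (Suc h - i))" .
  qed
qed

text \<open>By the q-binomial theorem this is the product of \<open>1 + q^i X\<close> over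
  \<open>1 \<le> i \<le> k\<close>.\<close>

definition q_delannoy_numer :: "nat \<Rightarrow> int poly fps" where
  "q_delannoy_numer k = Abs_fps (\<lambda>j. monom 1 ((j + 1) choose 2) * q_binomial k j)"

text \<open>The inverse of the product of \<open>1 - q^i X\<close> over
  \<open>0 \<le> i \<le> k\<close>, given by its coefficients.\<close>

definition q_delannoy_inv_denom :: "nat \<Rightarrow> int poly fps" where
  "q_delannoy_inv_denom k = Abs_fps (\<lambda>m. q_binomial (m + k) k)"

lemma q_delannoy_numer_Suc:
  "q_delannoy_numer (Suc k) = (1 + fps_const (monom 1 (Suc k)) * fps_X) * q_delannoy_numer k"
proof (rule fps_ext)
  fix j
  show "fps_nth (q_delannoy_numer (Suc k)) j
      = fps_nth ((1 + fps_const (monom 1 (Suc k)) * fps_X) * q_delannoy_numer k) j"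
  proof (cases j)
    case 0
    then show ?thesis by (simp add: q_delannoy_numer_def algebra_simps)
  next
    case (Suc l)
    have c: "(Suc l + 1) choose 2 = ((l + 1) choose 2) + Suc l"
      by (simp add: numeral_2_eq_2)
    \<comment> \<open>The triangular number grows by \<open>l + 1\<close>, which together with the
      Pascal exponent \<open>k - l\<close> gives \<open>k + 1\<close>, independent of
      \<open>l\<close>.\<close>
    have "monom 1 ((Suc l + 1) choose 2) * (monom 1 (k - l) * q_binomial k l)
        = monom 1 (Suc k) * (monom 1 ((l + 1) choose 2) * q_binomial k l)"
    proof (cases "l \<le> k")
      case True
      then have "((l + 1) choose 2) + Suc l + (k - l) = Suc k + ((l + 1) choose 2)" by simp
      then show ?thesis unfolding c mult.assoc[symmetric] mult_monom by (simp only: mult_1)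
    qed (simp add: q_binomial_eq_0)
    then show ?thesis
      by (simp add: Suc q_delannoy_numer_def q_binomial_Suc_Suc' distrib_left distrib_right mult.assoc)
  qed
qed

lemma q_delannoy_inv_denom_Suc:
  "(1 - fps_const (monom 1 (Suc k)) * fps_X) * q_delannoy_inv_denom (Suc k) = q_delannoy_inv_denom k"
proof (rule fps_ext)
  fix m
  show "fps_nth ((1 - fps_const (monom 1 (Suc k)) * fps_X) * q_delannoy_inv_denom (Suc k)) m
      = fps_nth (q_delannoy_inv_denom k) m"
    by (cases m) (simp_all add: q_delannoy_inv_denom_def left_diff_distrib mult.assoc q_binomial_Suc_Suc
        q_binomial_eq_0)
qed

text \<open>The sum defining \<open>q_delannoy\<close> is a Cauchy product, since
  \<open>h + k - j = (h - j) + k\<close> for \<open>j \<le> h\<close>.\<close>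

lemma Abs_fps_q_delannoy:
  "Abs_fps (\<lambda>h. q_delannoy h k) = q_delannoy_numer k * q_delannoy_inv_denom k"
  by (rule fps_ext)
    (simp add: fps_mult_nth q_delannoy_def q_delannoy_numer_def q_delannoy_inv_denom_def)

lemma q_delannoy_fps_Suc:
  "(1 - fps_const (monom 1 (Suc k)) * fps_X) * Abs_fps (\<lambda>h. q_delannoy h (Suc k))
     = (1 + fps_const (monom 1 (Suc k)) * fps_X) * Abs_fps (\<lambda>h. q_delannoy h k)"
  unfolding Abs_fps_q_delannoy q_delannoy_numer_Suc q_delannoy_inv_denom_Suc[of k, symmetric]
  by (simp only: mult_ac)

lemma q_delannoy_0_left: "q_delannoy 0 k = 1"
  by (simp add: q_delannoy_def binomial_eq_0)

lemma q_delannoy_Suc_Suc: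
  "q_delannoy (Suc h) (Suc k)
     = q_delannoy (Suc h) k + monom 1 (Suc k) * (q_delannoy h (Suc k) + q_delannoy h k)"
  using arg_cong[OF q_delannoy_fps_Suc[of k], of "\<lambda>f. fps_nth f (Suc h)"]
  by (simp add: left_diff_distrib distrib_right distrib_left mult.assoc algebra_simps)

section \<open>Evaluation at complex numbers\<close>

definition eval_int_poly :: "complex \<Rightarrow> int poly \<Rightarrow> complex" where
  "eval_int_poly z p = poly (map_poly of_int p) z"

lemma eval_int_poly_add [simp]: "eval_int_poly z (p + q) = eval_int_poly z p + eval_int_poly z q"
proof -
  have "map_poly of_int (p + q) = (map_poly of_int p + map_poly of_int q :: complex poly)"
    by (rule poly_eqI) (simp add: coeff_map_poly)
  then show ?thesis by (simp add: eval_int_poly_def)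
qed

lemma eval_int_poly_diff [simp]: "eval_int_poly z (p - q) = eval_int_poly z p - eval_int_poly z q"
  using eval_int_poly_add[of z "p - q" q] by simp

lemma eval_int_poly_mult [simp]: "eval_int_poly z (p * q) = eval_int_poly z p * eval_int_poly z q"
proof -
  have "map_poly of_int (p * q) = (map_poly of_int p * map_poly of_int q :: complex poly)"
    by (rule poly_eqI) (simp add: coeff_map_poly coeff_mult)
  then show ?thesis by (simp add: eval_int_poly_def)
qed

lemma eval_int_poly_1 [simp]: "eval_int_poly z 1 = 1"
  by (simp add: eval_int_poly_def)

lemma eval_int_poly_monom [simp]: "eval_int_poly z (monom c m) = of_int c * z ^ m"
  by (simp add: eval_int_poly_def map_poly_monom poly_monom)

text \<open>The remainder of \<open>f\<close> modulo \<open>cyclotomic n\<close> vanishes at all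
  primitive roots, which are as many as the degree of the divisor, so it is zero.\<close>

lemma cyclotomic_dvdI:
  assumes n: "n > 0"
    and roots: "\<And>z. z \<in> primitive_unity_roots n \<Longrightarrow> eval_int_poly z f = 0"
  shows "cyclotomic n dvd f"
proof -
  let ?U = "primitive_unity_roots n" and ?C = "cyclotomic n"
  note C = of_int_cyclotomic[OF n]
  have fin: "finite ?U" using n by (rule finite_primitive_unity_roots)
  have deg: "degree ?C = card ?U"
    using prod_linear_factors_props[OF fin] C degree_map_poly[of "of_int :: int \<Rightarrow> complex" ?C] by simp
  have "of_int (lead_coeff ?C) = (1 :: complex)"
    using prod_linear_factors_props[OF fin] deg by (auto simp: C[symmetric] coeff_map_poly)
  then have lC: "lead_coeff ?C = 1" by simp
  then have C0: "?C \<noteq> 0" by auto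
  obtain Q R where QR: "pseudo_divmod f ?C = (Q, R)" by fastforce
  \<comment> \<open>Since the divisor is monic, pseudo-division is genuine division over the
    integers.\<close>
  have div: "f = ?C * Q + R" and R: "R = 0 \<or> degree R < degree ?C"
    using pseudo_divmod[OF C0 QR] lC by simp_all
  have "R = 0"
  proof (rule ccontr)
    assume "R \<noteq> 0"
    let ?R = "map_poly of_int R :: complex poly"
    have R0: "?R \<noteq> 0" using \<open>R \<noteq> 0\<close> by (auto simp: poly_eq_iff coeff_map_poly)
    have "?U \<subseteq> {z. poly ?R z = 0}"
    proof
      fix z assume z: "z \<in> ?U"
      have "eval_int_poly z ?C = 0"
        unfolding eval_int_poly_def C poly_prod using z fin by (intro prod_zero) auto
      then show "z \<in> {z. poly ?R z = 0}"
        using roots[OF z] unfolding div by (simp add: eval_int_poly_def[of z R])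
    qed
    then have "card ?U \<le> card {z. poly ?R z = 0}"
      using R0 by (intro card_mono poly_roots_finite)
    also have "\<dots> \<le> degree ?R" using R0 by (rule card_poly_roots_bound)
    also have "\<dots> = degree R" by (simp add: degree_map_poly)
    finally show False using R \<open>R \<noteq> 0\<close> deg by simp
  qed
  then show ?thesis using div by simp
qed

section \<open>Products over roots of unity\<close>

lemma prod_one_minus_unity_roots:
  fixes y :: complex
  assumes n: "n > 0"
  shows "(\<Prod>w | w ^ n = 1. 1 - w * y) = 1 - y ^ n"
proof (cases "y = 0")
  case True
  then show ?thesis using n by simp
next
  case False
  \<comment> \<open>Pulling \<open>y\<close> out of each factor reduces to the factorisation of
    \<open>X^n - 1\<close>, evaluated at \<open>1 / y\<close>.\<close>
  have "(\<Prod>w | w ^ n = 1. 1 - w * y) = (\<Prod>w | w ^ n = 1. y * poly [:- w, 1:] (1 / y))"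
    using False by (intro prod.cong) (simp_all add: field_simps)
  also have "\<dots> = y ^ n * poly (\<Prod>w | w ^ n = 1. [:- w, 1:]) (1 / y)"
    using card_roots_unity_eq[OF n] by (simp add: prod.distrib poly_prod)
  also have "\<dots> = 1 - y ^ n"
    unfolding prod_unity_roots[OF n] using False by (simp add: poly_monom field_simps)
  finally show ?thesis .
qed

text \<open>Since \<open>z\<close> has order exactly \<open>n\<close>, the \<open>n\<close>
  consecutive powers are distinct, and there are only \<open>n\<close> roots of unity to
  hit.\<close>

lemma bij_betw_powers_primitive_unity_root:
  assumes n: "n > 0" and z: "z \<in> primitive_unity_roots n"
  shows "bij_betw (\<lambda>i. z ^ (m + i)) {..<n} {w. w ^ n = 1}"
proof -
  have z1: "z ^ n = 1" and prim: "\<And>m. 0 < m \<Longrightarrow> m < n \<Longrightarrow> z ^ m \<noteq> 1"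
    using z by (auto simp: primitive_unity_roots_def)
  have z0: "z \<noteq> 0" using z1 n by (auto simp: power_0_left)
  have neq: "z ^ (m + i) \<noteq> z ^ (m + j)" if "i < j" "j < n" for i j
  proof
    assume eq: "z ^ (m + i) = z ^ (m + j)"
    have "z ^ (m + j) = z ^ (m + i) * z ^ (j - i)"
      using that by (simp add: power_add[symmetric])
    then have "z ^ (j - i) = 1" using eq z0 by simp
    then show False using prim[of "j - i"] that by simp
  qed
  have inj: "inj_on (\<lambda>i. z ^ (m + i)) {..<n}"
    by (rule linorder_inj_onI) (auto dest: neq)
  have "(\<lambda>i. z ^ (m + i)) ` {..<n} = {w. w ^ n = 1}"
  proof (rule card_subset_eq)
    show "finite {w :: complex. w ^ n = 1}" using n by (intro finite_roots_unity) simp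
    show "(\<lambda>i. z ^ (m + i)) ` {..<n} \<subseteq> {w. w ^ n = 1}"
      using z1 by (auto simp: power_mult[symmetric] mult.commute[of _ n]) (simp add: power_mult)
    show "card ((\<lambda>i. z ^ (m + i)) ` {..<n}) = card {w :: complex. w ^ n = 1}"
      using inj card_roots_unity_eq[OF n] by (simp add: card_image)
  qed
  then show ?thesis using inj by (simp add: bij_betw_def)
qed

lemma prod_linear_fps_primitive_unity_root:
  fixes c :: complex
  assumes n: "n > 0" and z: "z \<in> primitive_unity_roots n"
  shows "(\<Prod>i<n. 1 - fps_const (c * z ^ (m + i)) * fps_X) = 1 - fps_const (c ^ n) * fps_X ^ n"
proof -
  \<comment> \<open>The identity is first proved for polynomials, where it can be checked pointwise,
    and then carried over to power series.\<close>
  have "(\<Prod>i<n. [:1, - (c * z ^ (m + i)):]) = 1 - monom (c ^ n) n" (is "?P = ?Q")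
  proof -
    have "poly ?P y = poly ?Q y" for y
    proof -
      have "poly ?P y = (\<Prod>i<n. 1 - z ^ (m + i) * (c * y))"
        by (simp add: poly_prod mult_ac)
      also have "\<dots> = (\<Prod>w | w ^ n = 1. 1 - w * (c * y))"
        by (rule prod.reindex_bij_betw[OF bij_betw_powers_primitive_unity_root[OF n z]])
      also have "\<dots> = poly ?Q y"
        unfolding prod_one_minus_unity_roots[OF n] by (simp add: poly_monom power_mult_distrib)
      finally show ?thesis .
    qed
    then show ?thesis by (simp add: poly_eq_poly_eq_iff[symmetric] fun_eq_iff)
  qed
  then have "fps_of_poly ?P = fps_of_poly ?Q" by (rule arg_cong)
  then show ?thesis
    by (simp add: fps_of_poly_prod fps_of_poly_pCons fps_of_poly_diff fps_of_poly_monom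
        flip: fps_const_neg)
qed

section \<open>\<open>q\<close>-Delannoy numbers at roots of unity\<close>

text \<open>Evaluation respects the recurrence, so coefficients can be compared: the constant terms
  are both 1, and the others agree by \<open>q_delannoy_Suc_Suc\<close>.\<close>

lemma eval_q_delannoy_step:
  "(1 - fps_const (z ^ Suc k) * fps_X) * Abs_fps (\<lambda>h. eval_int_poly z (q_delannoy h (Suc k)))
     = (1 + fps_const (z ^ Suc k) * fps_X) * Abs_fps (\<lambda>h. eval_int_poly z (q_delannoy h k))"
  (is "?L = ?R")
proof (rule fps_ext)
  fix h
  show "fps_nth ?L h = fps_nth ?R h"
    by (cases h)
      (simp_all add: q_delannoy_0_left q_delannoy_Suc_Suc left_diff_distrib distrib_right
        distrib_left mult.assoc)
qed

lemma eval_q_delannoy_steps: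
  "(\<Prod>i<m. 1 - fps_const (z ^ (Suc k + i)) * fps_X)
       * Abs_fps (\<lambda>h. eval_int_poly z (q_delannoy h (k + m)))
     = (\<Prod>i<m. 1 + fps_const (z ^ (Suc k + i)) * fps_X)
       * Abs_fps (\<lambda>h. eval_int_poly z (q_delannoy h k))"
proof (induction m)
  case (Suc m)
  show ?case
    using eval_q_delannoy_step[of z "k + m"] Suc.IH
    by (simp add: mult.assoc mult.left_commute)
qed simp

lemma eval_q_delannoy_add:
  assumes n: "n > 0" and z: "z \<in> primitive_unity_roots n"
  shows "eval_int_poly z (q_delannoy (h + n) (k + n))
    = eval_int_poly z (q_delannoy (h + n) k) + eval_int_poly z (q_delannoy h (k + n))
      - (- 1) ^ n * eval_int_poly z (q_delannoy h k)"
proof -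
  let ?G = "\<lambda>k. Abs_fps (\<lambda>h. eval_int_poly z (q_delannoy h k))"
  \<comment> \<open>The choices \<open>c = 1\<close> and \<open>c = - 1\<close> collapse the left
    and right products of the \<open>n\<close> steps.\<close>
  have "(1 - fps_X ^ n) * ?G (k + n) = (1 - fps_const ((- 1) ^ n) * fps_X ^ n) * ?G k"
    using eval_q_delannoy_steps[of z k n]
      prod_linear_fps_primitive_unity_root[OF n z, of 1 "Suc k"]
      prod_linear_fps_primitive_unity_root[OF n z, of "- 1" "Suc k"]
    by (simp flip: fps_const_neg)
  from arg_cong[OF this, of "\<lambda>f. fps_nth f (h + n)"] show ?thesis
    by (simp add: left_diff_distrib mult.assoc fps_X_power_mult_nth algebra_simps)
qed

theorem theorem1p2:
  fixes n h k :: nat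
  assumes "n \<ge> 1"
  shows "(odd n \<longrightarrow>
            cyclotomic n dvd
              q_delannoy (h + n) (k + n)
                - (q_delannoy (h + n) k + q_delannoy h (k + n) + q_delannoy h k)) \<and>
         (even n \<longrightarrow>
            cyclotomic n dvd
              q_delannoy (h + n) (k + n)
                - (q_delannoy (h + n) k + q_delannoy h (k + n) - q_delannoy h k))"
  using assms by (auto intro!: cyclotomic_dvdI simp: eval_q_delannoy_add)

end
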